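(* Let $X$ be a reflexive real Banach space, $C\subset X$ a nonempty closed bounded convex set, $f:X\to\mathbb{R}$ a convex, continuously Fréchet differentiable function whose Fréchet derivative $f'$ is uniformly continuous on $C$, and $g:X\to(-\infty,\infty]$ a proper, lower semicontinuous, convex function with $C\subset\{x\in X:g(x)<\infty\}$. Put $\varphi=f+g$. Let $\{x_k\}_{k\ge0}$ be a sequence generated by the generalized Frank-Wolfe algorithm from an arbitrary $x_0\in C$, with the stepsizes $\{\gamma_k\}$ selected by either the line minimization search method or the open loop rule. Then: (i) If $f$ is strictly convex, then $\{x_k\}$ converges weakly to the unique solution of $\min_{x\in C}\varphi(x)$. (ii) If $f$ is uniformly convex, then $\{x_k\}$ converges in norm to the unique solution of $\min_{x\in C}\varphi(x)$. (iii) If $C$ is compact in the norm topology, if the stepsizes $\{\gamma_k\}$ are selected by the open loop rule, and if $\{x_k\}$ has at most finitely many (norm) cluster points, then $\{x_k\}$ converges in norm to a solution of $\min_{x\in C}\varphi(x)$.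
   Context: $\langle\cdot,\cdot\rangle$ is the pairing between the dual $X^*$ and $X$. Generalized Frank-Wolfe algorithm for $\min_{x\in C}\varphi(x)=f(x)+g(x)$: given $x_0\in C$, for each $k\ge0$ choose $\bar x_k\in C$ to be a minimizer of $x\mapsto\langle f'(x_k),x\rangle+g(x)$ over $C$, and set $x_{k+1}=x_k+\gamma_k(\bar x_k-x_k)$. Line minimization search: $\gamma_k\in[0,1]$ is a minimizer of $\gamma\mapsto\varphi(x_k+\gamma(\bar x_k-x_k))$ over $[0,1]$. Open loop rule: $\{\gamma_k\}\subset(0,1]$ with $\lim_{k\to\infty}\gamma_k=0$ and $\sum_{k=0}^\infty\gamma_k=\infty$. A function $h:X\to\mathbb{R}$ is uniformly convex if there is a continuous function $\delta:[0,\infty)\to[0,\infty)$ with $\delta(0)=0$ and $\delta(t)>0$ for all $t>0$ such that $h(\lambda x+(1-\lambda)y)\le\lambda h(x)+(1-\lambda)h(y)-\lambda(1-\lambda)\delta(\|x-y\|)$ for all $\lambda\in(0,1)$ and $x,y\in X$. *)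

theory Defs
  imports "HOL-Analysis.Analysis"
begin

(* The canonical embedding into the bidual is blinfun.prod_left: blinfun.prod_left x sends a
   functional l to its value at x. *)
definition reflexive_space :: "'a::real_normed_vector itself \<Rightarrow> bool" where
  "reflexive_space _ \<longleftrightarrow>
     surj (blinfun.prod_left :: 'a \<Rightarrow> (('a \<Rightarrow>\<^sub>L real) \<Rightarrow>\<^sub>L real))"

definition weakly_converges_to :: "(nat \<Rightarrow> 'a::real_normed_vector) \<Rightarrow> 'a \<Rightarrow> bool" where
  "weakly_converges_to x z \<longleftrightarrow>
     (\<forall>l :: 'a \<Rightarrow>\<^sub>L real. (\<lambda>k. blinfun_apply l (x k)) \<longlonglongrightarrow> blinfun_apply l z)"

definition seq_cluster_point :: "(nat \<Rightarrow> 'a::topological_space) \<Rightarrow> 'a \<Rightarrow> bool" where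
  "seq_cluster_point x z \<longleftrightarrow>
     (\<forall>U. open U \<and> z \<in> U \<longrightarrow> (\<exists>\<^sub>F k in sequentially. x k \<in> U))"

definition strictly_convex :: "('a::real_vector \<Rightarrow> real) \<Rightarrow> bool" where
  "strictly_convex h \<longleftrightarrow>
     (\<forall>x y. \<forall>c\<in>{0<..<1}. x \<noteq> y \<longrightarrow>
        h (c *\<^sub>R x + (1 - c) *\<^sub>R y) < c * h x + (1 - c) * h y)"

definition uniformly_convex :: "('a::real_normed_vector \<Rightarrow> real) \<Rightarrow> bool" where
  "uniformly_convex h \<longleftrightarrow>
     (\<exists>\<delta> :: real \<Rightarrow> real.
        continuous_on {0..} \<delta> \<and> \<delta> 0 = 0 \<and> (\<forall>t>0. \<delta> t > 0) \<and>
        (\<forall>x y. \<forall>c\<in>{0<..<1}.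
           h (c *\<^sub>R x + (1 - c) *\<^sub>R y)
             \<le> c * h x + (1 - c) * h y - c * (1 - c) * \<delta> (norm (x - y))))"

definition proper_fun :: "('a \<Rightarrow> ereal) \<Rightarrow> bool" where
  "proper_fun g \<longleftrightarrow> (\<forall>x. g x \<noteq> -\<infinity>) \<and> (\<exists>x. g x \<noteq> \<infinity>)"

definition lower_semicontinuous :: "('a::topological_space \<Rightarrow> ereal) \<Rightarrow> bool" where
  "lower_semicontinuous g \<longleftrightarrow> (\<forall>x. g x \<le> Liminf (nhds x) g)"

(* Intended for functions that never take the value -\<infinity>, so that the right-hand side
   never adds infinities of opposite sign. *)
definition ereal_convex :: "('a::real_vector \<Rightarrow> ereal) \<Rightarrow> bool" where
  "ereal_convex g \<longleftrightarrow>
     (\<forall>x y. \<forall>c\<in>{0<..<1::real}.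
        g (c *\<^sub>R x + (1 - c) *\<^sub>R y) \<le> ereal c * g x + ereal (1 - c) * g y)"

abbreviation minimizer_on :: "'a set \<Rightarrow> ('a \<Rightarrow> ereal) \<Rightarrow> 'a \<Rightarrow> bool" where
  "minimizer_on S h x \<equiv> is_arg_min h (\<lambda>y. y \<in> S) x"

definition objective :: "('a \<Rightarrow> real) \<Rightarrow> ('a \<Rightarrow> ereal) \<Rightarrow> 'a \<Rightarrow> ereal" where
  "objective f g x = ereal (f x) + g x"

definition frank_wolfe ::
  "'a::real_normed_vector set \<Rightarrow> ('a \<Rightarrow> ('a \<Rightarrow>\<^sub>L real)) \<Rightarrow> ('a \<Rightarrow> ereal) \<Rightarrow>
   (nat \<Rightarrow> real) \<Rightarrow> (nat \<Rightarrow> 'a) \<Rightarrow> (nat \<Rightarrow> 'a) \<Rightarrow> bool" where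
  "frank_wolfe C f' g \<gamma> xbar x \<longleftrightarrow>
     x 0 \<in> C \<and>
     (\<forall>k. minimizer_on C (\<lambda>y. ereal (blinfun_apply (f' (x k)) y) + g y) (xbar k) \<and>
          x (Suc k) = x k + \<gamma> k *\<^sub>R (xbar k - x k))"

definition line_minimization ::
  "('a::real_vector \<Rightarrow> ereal) \<Rightarrow> (nat \<Rightarrow> real) \<Rightarrow> (nat \<Rightarrow> 'a) \<Rightarrow> (nat \<Rightarrow> 'a) \<Rightarrow> bool" where
  "line_minimization \<phi> \<gamma> xbar x \<longleftrightarrow>
     (\<forall>k. minimizer_on {0..1} (\<lambda>t. \<phi> (x k + t *\<^sub>R (xbar k - x k))) (\<gamma> k))"

definition open_loop :: "(nat \<Rightarrow> real) \<Rightarrow> bool" where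
  "open_loop \<gamma> \<longleftrightarrow>
     range \<gamma> \<subseteq> {0<..1} \<and> \<gamma> \<longlonglongrightarrow> 0 \<and>
     filterlim (\<lambda>n. \<Sum>k<n. \<gamma> k) at_top sequentially"

end

theory Submission
  imports Defs
begin

text \<open>Let \<open>m = inf \<phi>(C)\<close>. The tangent inequality at \<open>x\<^sub>k\<close> shows that the linearized decrease
  dominates \<open>\<phi> x\<^sub>k - m\<close>, so by uniform continuity of \<open>f'\<close> every sufficiently small step \<open>t\<close> satisfies
  \<open>\<phi> x\<^sub>k\<^sub>+\<^sub>1 - m \<le> (1 - t) (\<phi> x\<^sub>k - m) + t \<epsilon>\<close>; both stepsize rules then force \<open>\<phi> x\<^sub>k \<longrightarrow> m\<close>.
  In a reflexive space a decreasing sequence of nonempty bounded closed convex sets has a common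
  point. Applied to sublevel sets of \<open>\<phi>\<close> this gives a minimizer \<open>z\<close>; applied to sublevel sets cut
  with the half-space \<open>l \<ge> l z + \<epsilon>\<close> it shows that a minimizing sequence entering it infinitely
  often would produce a second minimizer, whence weak convergence when \<open>f\<close> is strictly convex.\<close>

section \<open>Sublinear functionals and separation\<close>

definition sublinear :: "('v::real_vector \<Rightarrow> real) \<Rightarrow> bool" where
  "sublinear p \<longleftrightarrow> (\<forall>x y. p (x + y) \<le> p x + p y) \<and> (\<forall>c\<ge>0. \<forall>x. p (c *\<^sub>R x) = c * p x)"

lemma sublinear_add: "sublinear p \<Longrightarrow> p (x + y) \<le> p x + p y"
  by (simp add: sublinear_def)

lemma sublinear_scale: "sublinear p \<Longrightarrow> 0 \<le> c \<Longrightarrow> p (c *\<^sub>R x) = c * p x"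
  by (simp add: sublinear_def)

lemma sublinear_zero: "sublinear p \<Longrightarrow> p 0 = 0"
  using sublinear_scale[of p 0 0] by simp

lemma sublinear_ge_uminus: "sublinear p \<Longrightarrow> - p (- x) \<le> p x"
  using sublinear_add[of p x "- x"] by (simp add: sublinear_zero)

text \<open>The bound in \<open>scale\<close>, applied with factor \<open>1 / c\<close> at
  \<open>c *\<^sub>R x\<close>, gives the reverse inequality. Halving and doubling at the origin
  force \<open>p 0 = 0\<close>.\<close>

lemma sublinearI:
  assumes add: "\<And>x y. p (x + y) \<le> p x + p y"
    and scale: "\<And>c x. 0 < c \<Longrightarrow> p (c *\<^sub>R x) \<le> c * p x"
  shows "sublinear p"
proof -
  have "p 0 = 0"
    using add[of 0 0] scale[of "1/2" 0] by simp
  moreover have "c * p x \<le> p (c *\<^sub>R x)" if "0 < c" for c x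
    using scale[of "1 / c" "c *\<^sub>R x"] that by (simp add: field_simps)
  ultimately show ?thesis
    unfolding sublinear_def using assms by (metis antisym less_eq_real_def mult_zero_left scaleR_zero_left)
qed

text \<open>The members of the family may individually fail to be sublinear: each inequality only
  has to be met by some further member, and this passes to the infimum. The lemma serves for chains
  of sublinear functions, for perturbations along a direction, for the separation functional and for
  support functions.\<close>

lemma sublinear_INF:
  fixes F :: "'i \<Rightarrow> 'v::real_vector \<Rightarrow> real"
  assumes ne: "I \<noteq> {}"
    and bdd: "\<And>x. bdd_below ((\<lambda>i. F i x) ` I)"
    and add: "\<And>i j x y. i \<in> I \<Longrightarrow> j \<in> I \<Longrightarrow> \<exists>k\<in>I. F k (x + y) \<le> F i x + F j y"
    and scale: "\<And>i c x. i \<in> I \<Longrightarrow> 0 < c \<Longrightarrow> \<exists>k\<in>I. F k (c *\<^sub>R x) \<le> c * F i x"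
  shows "sublinear (\<lambda>x. INF i\<in>I. F i x)"
proof (rule sublinearI)
  let ?p = "\<lambda>x. INF i\<in>I. F i x"
  have le: "?p x \<le> F i x" if "i \<in> I" for i x
    using bdd that by (rule cINF_lower)
  fix x y
  have "?p (x + y) - F j y \<le> F i x" if ij: "i \<in> I" "j \<in> I" for i j
    using add[OF ij, of x y] le[of _ "x + y"] by fastforce
  then have "?p (x + y) - F j y \<le> ?p x" if "j \<in> I" for j
    using that by (intro cINF_greatest ne) auto
  then have "?p (x + y) - ?p x \<le> F j y" if "j \<in> I" for j
    using that by fastforce
  then have "?p (x + y) - ?p x \<le> ?p y"
    by (intro cINF_greatest ne) auto
  then show "?p (x + y) \<le> ?p x + ?p y"
    by simp
next
  let ?p = "\<lambda>x. INF i\<in>I. F i x"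
  fix c :: real and x
  assume c: "0 < c"
  have "?p (c *\<^sub>R x) / c \<le> F i x" if "i \<in> I" for i
  proof -
    obtain k where k: "k \<in> I" "F k (c *\<^sub>R x) \<le> c * F i x"
      using scale[OF \<open>i \<in> I\<close> c] by blast
    have "?p (c *\<^sub>R x) \<le> F k (c *\<^sub>R x)"
      using bdd k(1) by (rule cINF_lower)
    with k(2) c show ?thesis
      by (simp add: field_simps)
  qed
  then have "?p (c *\<^sub>R x) / c \<le> ?p x"
    by (intro cINF_greatest ne) auto
  then show "?p (c *\<^sub>R x) \<le> c * ?p x"
    using c by (simp add: field_simps)
qed

text \<open>The Hahn-Banach theorem in the form of Koenig: by Zorn's lemma there is a minimal sublinear
  \<open>q \<le> p\<close>, and minimality against \<open>x \<mapsto> INF t\<ge>0. q (x + t a) - t q a\<close> makes \<open>q\<close> superadditive.\<close>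

theorem sublinear_linear_minorant:
  fixes p :: "'v::real_vector \<Rightarrow> real"
  assumes p: "sublinear p"
  shows "\<exists>l. linear l \<and> (\<forall>x. l x \<le> p x)"
proof -
  define A where "A = {q. sublinear q \<and> q \<le> p}"
  \<comment> \<open>The order is reversed, so that a maximal element in Zorn's lemma is a minimal
    sublinear function.\<close>
  define P where "P = (\<lambda>q r :: 'v \<Rightarrow> real. r \<le> q)"
  \<comment> \<open>This bound does not depend on \<open>q\<close>, so pointwise infima over chains
    in \<open>A\<close> stay finite.\<close>
  have lower: "- p (- x) \<le> q x" if "q \<in> A" for q x
  proof -
    have "- q (- x) \<le> q x" "q (- x) \<le> p (- x)"
      using that sublinear_ge_uminus[of q x] by (auto simp: A_def le_fun_def)
    then show ?thesis by simp
  qed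
  have po: "partial_order_on A (relation_of P A)"
    by (auto simp: partial_order_on_def preorder_on_def refl_on_def trans_def antisym_def
        relation_of_def P_def)
  have "\<exists>m\<in>A. \<forall>a\<in>A. P m a \<longrightarrow> a = m"
  proof (rule predicate_Zorn[OF po])
    fix Q assume Q: "Q \<in> Chains (relation_of P A)"
    then have QA: "Q \<subseteq> A" and chain: "\<And>q r. q \<in> Q \<Longrightarrow> r \<in> Q \<Longrightarrow> q \<le> r \<or> r \<le> q"
      by (auto simp: Chains_def relation_of_def P_def)
    show "\<exists>u\<in>A. \<forall>a\<in>Q. P a u"
    proof (cases "Q = {}")
      case True
      then show ?thesis using p by (auto simp: A_def)
    next
      case False
      define u where "u = (\<lambda>x. INF q\<in>Q. q x)"
      have bdd: "bdd_below ((\<lambda>q. q x) ` Q)" for x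
        using lower QA by (intro bdd_belowI2[where m = "- p (- x)"]) auto
      have "sublinear u"
        unfolding u_def
      proof (rule sublinear_INF[OF False bdd])
        fix q r x y assume qr: "q \<in> Q" "r \<in> Q"
        then obtain s where s: "s \<in> Q" "s \<le> q" "s \<le> r"
          using chain[OF qr] by blast
        then have "s (x + y) \<le> s x + s y"
          using QA by (auto simp: A_def intro: sublinear_add)
        then show "\<exists>k\<in>Q. k (x + y) \<le> q x + r y"
          using s by (intro bexI[of _ s]) (force simp: le_fun_def dest: spec[of _ x] spec[of _ y])+
      next
        fix q c x assume "q \<in> Q" "(0::real) < c"
        then show "\<exists>k\<in>Q. k (c *\<^sub>R x) \<le> c * q x"
          using QA by (intro bexI[of _ q]) (auto simp: A_def sublinear_scale)
      qed
      moreover have le: "u \<le> q" if "q \<in> Q" for q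
        unfolding u_def le_fun_def using bdd that by (auto intro: cINF_lower)
      moreover have "u \<le> p"
        using False le QA by (force simp: A_def intro: order_trans)
      ultimately show ?thesis
        by (auto simp: A_def P_def)
    qed
  qed
  then obtain q where q: "sublinear q" "q \<le> p"
    and min: "\<And>r. sublinear r \<Longrightarrow> r \<le> q \<Longrightarrow> r = q"
    by (auto simp: A_def P_def)
  have super: "q x + q a \<le> q (x + a)" for x a
  proof -
    define r where "r = (\<lambda>x. INF t\<in>{0::real..}. q (x + t *\<^sub>R a) - t * q a)"
    have bdd: "bdd_below ((\<lambda>t. q (x + t *\<^sub>R a) - t * q a) ` {0..})" for x
    proof (rule bdd_belowI2[where m = "- q (- x)"])
      fix t :: real assume "t \<in> {0..}"
      then show "- q (- x) \<le> q (x + t *\<^sub>R a) - t * q a"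
        using sublinear_add[OF q(1), of "x + t *\<^sub>R a" "- x"] sublinear_scale[OF q(1), of t a] by simp
    qed
    have r_le: "r x \<le> q (x + t *\<^sub>R a) - t * q a" if "0 \<le> t" for t x
      unfolding r_def using bdd that by (intro cINF_lower) auto
    have "sublinear r"
      unfolding r_def
    proof (rule sublinear_INF[OF _ bdd])
      fix s t :: real and x y assume "s \<in> {0..}" "t \<in> {0..}"
      then show "\<exists>k\<in>{0..}. q (x + y + k *\<^sub>R a) - k * q a
          \<le> q (x + s *\<^sub>R a) - s * q a + (q (y + t *\<^sub>R a) - t * q a)"
        using sublinear_add[OF q(1), of "x + s *\<^sub>R a" "y + t *\<^sub>R a"]
        by (intro bexI[of _ "s + t"]) (auto simp: algebra_simps)
    next
      fix t c :: real and x assume "t \<in> {0..}" "0 < c"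
      then show "\<exists>k\<in>{0..}. q (c *\<^sub>R x + k *\<^sub>R a) - k * q a \<le> c * (q (x + t *\<^sub>R a) - t * q a)"
        using sublinear_scale[OF q(1), of c "x + t *\<^sub>R a"]
        by (intro bexI[of _ "c * t"]) (auto simp: algebra_simps)
    qed auto
    moreover have "r \<le> q"
      unfolding le_fun_def using r_le[of 0] by simp
    ultimately have "r = q"
      by (rule min)
    then show ?thesis
      \<comment> \<open>With \<open>r = q\<close>, the bound for \<open>t = 1\<close> reads
        \<open>q x \<le> q (x + a) - q a\<close>.\<close>
      using r_le[of 1 x] by simp
  qed
  have add: "q (x + y) = q x + q y" for x y
    using super sublinear_add[OF q(1)] by (metis antisym)
  have neg: "q (- x) = - q x" for x
    using add[of x "- x"] sublinear_zero[OF q(1)] by simp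
  have "q (c *\<^sub>R x) = c * q x" for c x
  proof (cases "0 \<le> c")
    case False
    then show ?thesis
      using sublinear_scale[OF q(1), of "- c" x] neg[of "c *\<^sub>R x"] by simp
  qed (simp add: sublinear_scale[OF q(1)])
  with add q(2) show ?thesis
    by (intro exI[of _ q]) (auto simp: le_fun_def intro: linearI)
qed

section \<open>Separation of a point from a closed convex set\<close>

lemma blinfun_of_linear_bounded:
  fixes l :: "'v::real_normed_vector \<Rightarrow> real"
  assumes "linear l" and "\<And>x. l x \<le> B * norm x"
  shows "\<exists>L. \<forall>x. blinfun_apply L x = l x"
proof -
  have "\<bar>l x\<bar> \<le> norm x * B" for x
    using assms(2)[of x] assms(2)[of "- x"] by (simp add: linear_neg[OF assms(1)] mult.commute)
  then have "bounded_linear l"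
    using assms(1) by (intro bounded_linear_intro[where K = B]) (auto simp: linear_add linear_scale)
  then show ?thesis
    by (metis bounded_linear_Blinfun_apply)
qed

text \<open>A linear minorant of a suitable sublinear \<open>p\<close> separates: choosing
  \<open>t = 0\<close> bounds \<open>p\<close> by the norm, which gives continuity, and choosing
  \<open>t = 1\<close> at \<open>k - z\<close> gives \<open>p (k - z) \<le> - d\<close>, where
  \<open>d\<close> bounds the distance from \<open>z\<close> to \<open>K\<close> from below.\<close>

theorem separating_functional_closed_point:
  fixes K :: "'v::real_normed_vector set"
  assumes K: "closed K" "convex K" "K \<noteq> {}" and z: "z \<notin> K"
  shows "\<exists>(l :: 'v \<Rightarrow>\<^sub>L real) d. 0 < d \<and> (\<forall>k\<in>K. l k \<le> l z - d)"
proof -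
  obtain d where "0 < d" "ball z d \<subseteq> - K"
    using K(1) z by (metis ComplI open_Compl open_contains_ball)
  then have d: "0 < d" "\<And>k. k \<in> K \<Longrightarrow> d \<le> norm (z - k)"
    by (force simp: dist_norm subset_iff not_le[symmetric])+
  define F where "F = (\<lambda>(t::real, k) y. norm (y + t *\<^sub>R (z - k)) - t * d)"
  define p where "p = (\<lambda>y. INF i\<in>{0..} \<times> K. F i y)"
  have bdd: "bdd_below ((\<lambda>i. F i y) ` ({0..} \<times> K))" for y
  proof (rule bdd_belowI2[where m = "- norm y"])
    fix i assume "i \<in> {0::real..} \<times> K"
    then obtain t k where i: "i = (t, k)" "0 \<le> t" "k \<in> K"
      by auto
    have "t * d \<le> norm (t *\<^sub>R (z - k))"
      using i d(2)[of k] by (simp add: mult_left_mono)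
    also have "\<dots> \<le> norm (y + t *\<^sub>R (z - k)) + norm y"
      using norm_triangle_ineq4[of "y + t *\<^sub>R (z - k)" y] by simp
    finally show "- norm y \<le> F i y"
      by (simp add: F_def i)
  qed
  have p_le: "p y \<le> norm (y + t *\<^sub>R (z - k)) - t * d" if "0 \<le> t" "k \<in> K" for t k y
    using cINF_lower[OF bdd, of "(t, k)" y] that by (simp add: p_def F_def)
  have "sublinear p"
    unfolding p_def
  proof (rule sublinear_INF[OF _ bdd])
    fix i j x y assume "i \<in> {0::real..} \<times> K" "j \<in> {0::real..} \<times> K"
    then obtain s k t k' where i: "i = (s, k)" "0 \<le> s" "k \<in> K" and j: "j = (t, k')" "0 \<le> t" "k' \<in> K"
      by auto
    \<comment> \<open>Convexity supplies the weighted mean of \<open>k\<close> and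
      \<open>k'\<close>; if both weights vanish, any point of \<open>K\<close> will do.\<close>
    obtain m where m: "m \<in> K" "(s + t) *\<^sub>R m = s *\<^sub>R k + t *\<^sub>R k'"
    proof (cases "s + t = 0")
      case True
      then have "s = 0" "t = 0" using i j by auto
      then show ?thesis using that[of k] i by simp
    next
      case False
      have "(s / (s + t)) *\<^sub>R k + (t / (s + t)) *\<^sub>R k' \<in> K"
        using i j False by (intro convexD[OF K(2)]) (auto simp: add_divide_distrib[symmetric])
      then show ?thesis
        using that False by (auto simp: scaleR_add_right)
    qed
    have "x + y + (s + t) *\<^sub>R (z - m) = (x + s *\<^sub>R (z - k)) + (y + t *\<^sub>R (z - k'))"
      using m(2) by (simp add: algebra_simps)
    then have "norm (x + y + (s + t) *\<^sub>R (z - m))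
        \<le> norm (x + s *\<^sub>R (z - k)) + norm (y + t *\<^sub>R (z - k'))"
      by (metis norm_triangle_ineq)
    then show "\<exists>k\<in>{0..} \<times> K. F k (x + y) \<le> F i x + F j y"
      using i j m by (intro bexI[of _ "(s + t, m)"]) (auto simp: F_def algebra_simps)
  next
    fix i c x assume "i \<in> {0::real..} \<times> K" and c: "(0::real) < c"
    then obtain t k where i: "i = (t, k)" "0 \<le> t" "k \<in> K"
      by auto
    have "norm (c *\<^sub>R x + (c * t) *\<^sub>R (z - k)) = c * norm (x + t *\<^sub>R (z - k))"
      using c by (metis abs_of_pos norm_scaleR scaleR_add_right scaleR_scaleR)
    then show "\<exists>k\<in>{0..} \<times> K. F k (c *\<^sub>R x) \<le> c * F i x"
      using i c by (intro bexI[of _ "(c * t, k)"]) (auto simp: F_def algebra_simps)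
  qed (use K in auto)
  then obtain l where l: "linear l" "\<And>x. l x \<le> p x"
    using sublinear_linear_minorant by blast
  obtain k0 where "k0 \<in> K"
    using K by auto
  then have "l x \<le> 1 * norm x" for x
    using l(2)[of x] p_le[of 0 k0 x] by simp
  then obtain L :: "'v \<Rightarrow>\<^sub>L real" where L: "\<And>x. L x = l x"
    using blinfun_of_linear_bounded[OF l(1)] by blast
  have "L k \<le> L z - d" if "k \<in> K" for k
    using l(2)[of "k - z"] p_le[of 1 k "k - z"] that by (simp add: L linear_diff[OF l(1)])
  with d(1) show ?thesis
    by blast
qed

section \<open>Nested bounded closed convex sets in a reflexive space\<close>

text \<open>The infimum of the support functions of the \<open>K n\<close> is sublinear on the dual
  because the sets decrease. A linear minorant of it is bounded, hence by reflexivity is evaluation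
  at some \<open>z\<close>, and a point dominated by the support function of a closed convex set
  cannot be separated from that set.\<close>

theorem reflexive_decreasing_Inter_nonempty:
  fixes K :: "nat \<Rightarrow> 'v::real_normed_vector set"
  assumes refl: "reflexive_space TYPE('v)"
    and K: "\<And>n. closed (K n)" "\<And>n. convex (K n)" "\<And>n. K n \<noteq> {}"
    and dec: "decseq K" and bnd: "bounded (K 0)"
  shows "(\<Inter>n. K n) \<noteq> {}"
proof -
  obtain B where B: "\<And>y. y \<in> K 0 \<Longrightarrow> norm y \<le> B"
    using bnd by (auto simp: bounded_iff)
  have B': "norm y \<le> B" if "y \<in> K n" for n y
    using B decseqD[OF dec, of 0 n] that by auto
  have abs_le: "\<bar>blinfun_apply l y\<bar> \<le> B * norm l" if "y \<in> K n" for l :: "'v \<Rightarrow>\<^sub>L real" and y n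
  proof -
    have "\<bar>blinfun_apply l y\<bar> \<le> norm l * norm y"
      using norm_blinfun[of l y] by simp
    also have "\<dots> \<le> norm l * B"
      using B'[OF that] by (intro mult_left_mono) auto
    finally show ?thesis
      by (simp add: mult.commute)
  qed
  define F where "F = (\<lambda>n (l :: 'v \<Rightarrow>\<^sub>L real). SUP y\<in>K n. l y)"
  have bddF: "bdd_above ((\<lambda>y. blinfun_apply l y) ` K n)" for l :: "'v \<Rightarrow>\<^sub>L real" and n
    using abs_le by (intro bdd_aboveI2[where M = "B * norm l"]) (meson abs_le_iff)
  have le_F: "l y \<le> F n l" if "y \<in> K n" for l :: "'v \<Rightarrow>\<^sub>L real" and y n
    unfolding F_def using bddF that by (intro cSUP_upper)
  have F_le: "F n l \<le> c" if "\<And>y. y \<in> K n \<Longrightarrow> l y \<le> c" for l :: "'v \<Rightarrow>\<^sub>L real" and n c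
    unfolding F_def using K(3) that by (intro cSUP_least)
  have bdd: "bdd_below ((\<lambda>n. F n l) ` UNIV)" for l
  proof (rule bdd_belowI2[where m = "- (B * norm l)"])
    fix n
    obtain y where "y \<in> K n"
      using K(3) by blast
    then show "- (B * norm l) \<le> F n l"
      using le_F abs_le by (meson abs_le_D2 minus_le_iff order_trans)
  qed
  have "sublinear (\<lambda>l. INF n. F n l)"
  proof (rule sublinear_INF[OF _ bdd])
    fix i j :: nat and l m
    \<comment> \<open>The set with the larger index lies in both \<open>K i\<close> and
      \<open>K j\<close>, so both suprema bound its points.\<close>
    have "F (max i j) (l + m) \<le> F i l + F j m"
    proof (rule F_le)
      fix y assume "y \<in> K (max i j)"
      then have "y \<in> K i" "y \<in> K j"
        using decseqD[OF dec, of i "max i j"] decseqD[OF dec, of j "max i j"] by auto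
      then show "blinfun_apply (l + m) y \<le> F i l + F j m"
        using le_F by (simp add: plus_blinfun.rep_eq add_mono)
    qed
    then show "\<exists>k\<in>UNIV. F k (l + m) \<le> F i l + F j m"
      by blast
  next
    fix i :: nat and c :: real and l assume "0 < c"
    then have "F i (c *\<^sub>R l) \<le> c * F i l"
      using le_F by (intro F_le) (simp add: scaleR_blinfun.rep_eq)
    then show "\<exists>k\<in>UNIV. F k (c *\<^sub>R l) \<le> c * F i l"
      by blast
  qed auto
  then obtain \<Lambda> where \<Lambda>: "linear \<Lambda>" "\<And>l. \<Lambda> l \<le> (INF n. F n l)"
    using sublinear_linear_minorant by blast
  have \<Lambda>_le: "\<Lambda> l \<le> F n l" for l n
    using \<Lambda>(2) cINF_lower[OF bdd, of n l] by (meson UNIV_I order_trans)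
  have "\<Lambda> l \<le> B * norm l" for l
    using \<Lambda>_le[of l 0] F_le[of 0 l "B * norm l"] abs_le by (meson abs_le_D1 order_trans)
  then obtain L :: "('v \<Rightarrow>\<^sub>L real) \<Rightarrow>\<^sub>L real" where L: "\<And>l. L l = \<Lambda> l"
    using blinfun_of_linear_bounded[OF \<Lambda>(1)] by blast
  obtain z :: 'v where "L = blinfun.prod_left z"
    using refl unfolding reflexive_space_def surj_def by blast
  then have z: "\<Lambda> l = l z" for l :: "'v \<Rightarrow>\<^sub>L real"
    using L[of l] by simp
  have "z \<in> K n" for n
  proof (rule ccontr)
    assume "z \<notin> K n"
    then obtain l :: "'v \<Rightarrow>\<^sub>L real" and d where "0 < d" "\<And>k. k \<in> K n \<Longrightarrow> l k \<le> l z - d"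
      using separating_functional_closed_point[OF K] by metis
    \<comment> \<open>Separation would give \<open>F n l \<le> l z - d\<close>, whereas
      \<open>l z = \<Lambda> l \<le> F n l\<close>.\<close>
    then show False
      using F_le[of n l "l z - d"] \<Lambda>_le[of l n] by (simp add: z)
  qed
  then show ?thesis
    by blast
qed

section \<open>Convex functions and cluster points of sequences\<close>

text \<open>Restriction to the line through \<open>y\<close> and \<open>w\<close> reduces the claim
  to the tangent inequality in one real variable, between the parameters 0 and 1.\<close>

lemma convex_on_above_tangent:
  fixes f :: "'v::real_normed_vector \<Rightarrow> real"
  assumes f: "convex_on UNIV f" and D: "(f has_derivative D) (at y)"
  shows "f y + D (w - y) \<le> f w"
proof -
  define h where "h = (\<lambda>t::real. f (y + t *\<^sub>R (w - y)))"
  have "convex_on UNIV h"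
  proof (rule convex_onI)
    fix t a b :: real assume "0 < t" "t < 1"
    moreover have "y + ((1 - t) *\<^sub>R a + t *\<^sub>R b) *\<^sub>R (w - y)
        = (1 - t) *\<^sub>R (y + a *\<^sub>R (w - y)) + t *\<^sub>R (y + b *\<^sub>R (w - y))"
      by (simp add: algebra_simps)
    ultimately show "h ((1 - t) *\<^sub>R a + t *\<^sub>R b) \<le> (1 - t) * h a + t * h b"
      unfolding h_def using convex_onD[OF f, of t] by simp
  qed auto
  moreover have "(h has_field_derivative D (w - y)) (at 0)"
  proof -
    have "((\<lambda>t::real. y + t *\<^sub>R (w - y)) has_derivative (\<lambda>t. t *\<^sub>R (w - y))) (at 0)"
      by (auto intro!: derivative_eq_intros)
    moreover have "(f has_derivative D) (at (y + 0 *\<^sub>R (w - y)))"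
      using D by simp
    ultimately have "(h has_derivative (\<lambda>t. D (t *\<^sub>R (w - y)))) (at 0)"
      unfolding h_def by (rule has_derivative_compose)
    then show ?thesis
      by (simp add: has_field_derivative_def linear_scale[OF has_derivative_linear[OF D]] mult_commute_abs)
  qed
  ultimately have "h 1 - h 0 \<ge> D (w - y) * (1 - 0)"
    by (intro convex_on_imp_above_tangent[of UNIV]) auto
  then show ?thesis
    by (simp add: h_def)
qed

lemma uniformly_convex_imp_strictly_convex:
  fixes h :: "'v::real_normed_vector \<Rightarrow> real"
  assumes "uniformly_convex h"
  shows "strictly_convex h"
proof -
  obtain \<delta> where \<delta>: "\<And>t. 0 < t \<Longrightarrow> 0 < \<delta> t"
    and uc: "\<And>x y c. c \<in> {0<..<1} \<Longrightarrow> h (c *\<^sub>R x + (1 - c) *\<^sub>R y)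
      \<le> c * h x + (1 - c) * h y - c * (1 - c) * \<delta> (norm (x - y))"
    using assms unfolding uniformly_convex_def by metis
  show ?thesis
    unfolding strictly_convex_def
  proof (intro allI ballI impI)
    fix x y :: 'v and c :: real assume c: "c \<in> {0<..<1}" and "x \<noteq> y"
    then have "0 < c * (1 - c) * \<delta> (norm (x - y))"
      using \<delta> by auto
    then show "h (c *\<^sub>R x + (1 - c) *\<^sub>R y) < c * h x + (1 - c) * h y"
      using uc[OF c, of x y] by linarith
  qed
qed

section \<open>A scalar recursion with divergent weights\<close>

text \<open>The excess \<open>h k - \<epsilon>\<close> is multiplied by at most
  \<open>1 - \<sigma> k \<le> exp (- \<sigma> k)\<close> in each step, so it is dominated by a
  multiple of the exponential of minus the partial sums, which tends to 0.\<close>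

lemma averaged_recursion_eventually_less:
  fixes h \<sigma> :: "nat \<Rightarrow> real"
  assumes step: "\<forall>\<^sub>F k in sequentially. \<sigma> k \<le> 1 \<and> h (Suc k) \<le> (1 - \<sigma> k) * h k + \<sigma> k * \<epsilon>"
    and div: "filterlim (\<lambda>n. \<Sum>k<n. \<sigma> k) at_top sequentially"
    and "\<epsilon> < \<delta>"
  shows "\<forall>\<^sub>F k in sequentially. h k < \<delta>"
proof -
  obtain N where N: "\<And>k. N \<le> k \<Longrightarrow> \<sigma> k \<le> 1 \<and> h (Suc k) \<le> (1 - \<sigma> k) * h k + \<sigma> k * \<epsilon>"
    using step by (auto simp: eventually_sequentially)
  define S where "S = (\<lambda>n. \<Sum>k<n. \<sigma> k)"
  \<comment> \<open>Truncation at 0 makes the majorant nonnegative, so that replacing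
    \<open>1 - \<sigma> n\<close> by the larger exponential preserves the inequality.\<close>
  define M where "M = max 0 (h N - \<epsilon>)"
  have bound: "h n - \<epsilon> \<le> M * exp (S N - S n)" if "N \<le> n" for n
    using that
  proof (induction n rule: dec_induct)
    case (step n)
    have "h (Suc n) - \<epsilon> \<le> (1 - \<sigma> n) * (h n - \<epsilon>)"
      using N[OF step.hyps(1)] by (simp add: algebra_simps)
    also have "\<dots> \<le> (1 - \<sigma> n) * (M * exp (S N - S n))"
      using N[OF step.hyps(1)] step.IH by (intro mult_left_mono) auto
    also have "\<dots> \<le> exp (- \<sigma> n) * (M * exp (S N - S n))"
      using exp_ge_add_one_self[of "- \<sigma> n"] by (intro mult_right_mono) (auto simp: M_def)
    also have "\<dots> = M * exp (S N - S (Suc n))"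
      by (simp add: S_def exp_add[symmetric] algebra_simps)
    finally show ?case .
  qed (simp add: M_def)
  have "(\<lambda>n. exp (- S n)) \<longlonglongrightarrow> 0"
    using div by (intro filterlim_compose[OF exp_at_bot]) (simp add: filterlim_uminus_at_bot S_def)
  then have "(\<lambda>n. M * exp (S N) * exp (- S n)) \<longlonglongrightarrow> M * exp (S N) * 0"
    by (rule tendsto_mult_left)
  then have "(\<lambda>n. M * exp (S N - S n)) \<longlonglongrightarrow> 0"
    by (simp add: exp_diff exp_minus divide_inverse mult.assoc)
  then have "\<forall>\<^sub>F n in sequentially. M * exp (S N - S n) < \<delta> - \<epsilon>"
    using \<open>\<epsilon> < \<delta>\<close> by (intro order_tendstoD) auto
  then show ?thesis
    using eventually_ge_at_top[of N]
  proof eventually_elim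
    case (elim n)
    then show ?case using bound[of n] by simp
  qed
qed

section \<open>Cluster points in compact sets\<close>

text \<open>The visits to \<open>A\<close> form a subsequence, and by compactness a further
  subsequence of it converges in \<open>A\<close>; its limit is the cluster point.\<close>

lemma frequently_in_compact_imp_cluster_point:
  fixes x :: "nat \<Rightarrow> 'm::metric_space"
  assumes A: "compact A" and freq: "\<exists>\<^sub>F k in sequentially. x k \<in> A"
  shows "\<exists>z\<in>A. seq_cluster_point x z"
proof -
  have inf: "infinite {k. x k \<in> A}"
    using freq by (simp add: frequently_cofinite[symmetric] cofinite_eq_sequentially)
  define s where "s = enumerate {k. x k \<in> A}"
  have s: "strict_mono s" "\<And>n. x (s n) \<in> A"
    using strict_mono_enumerate[OF inf] enumerate_in_set[OF inf] by (auto simp: s_def)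
  obtain z r where z: "z \<in> A" and r: "strict_mono r" "((\<lambda>n. x (s n)) \<circ> r) \<longlonglongrightarrow> z"
    using A s(2) unfolding compact_eq_seq_compact_metric seq_compact_def
    by (metis (mono_tags, lifting))
  have "seq_cluster_point x z"
    unfolding seq_cluster_point_def
  proof (intro allI impI)
    fix U assume "open U \<and> z \<in> U"
    then have "\<forall>\<^sub>F n in sequentially. x (s (r n)) \<in> U"
      using topological_tendstoD[OF r(2)] by (simp add: o_def)
    then obtain M where M: "\<And>n. M \<le> n \<Longrightarrow> x (s (r n)) \<in> U"
      by (auto simp: eventually_sequentially)
    have "n \<le> s (r n)" for n
      using seq_suble[OF s(1), of "r n"] seq_suble[OF r(1), of n] by simp
    then have "\<exists>k\<ge>N. x k \<in> U" for N
      using M[of "max M N"] by (meson max.boundedE max.cobounded1 order_refl order_trans)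
    then show "\<exists>\<^sub>F k in sequentially. x k \<in> U"
      by (simp add: frequently_sequentially)
  qed
  with z show ?thesis
    by blast
qed

text \<open>Since the steps tend to zero, the sequence cannot jump over a shell around an isolated
  cluster point, and by compactness it visits the shell only finitely often.\<close>

lemma finitely_many_cluster_points_imp_convergent:
  fixes x :: "nat \<Rightarrow> 'm::metric_space"
  assumes C: "compact C" "\<And>k. x k \<in> C"
    and steps: "(\<lambda>k. dist (x (Suc k)) (x k)) \<longlonglongrightarrow> 0"
    and fin: "finite {z. seq_cluster_point x z}"
  shows "\<exists>z\<in>C. seq_cluster_point x z \<and> x \<longlonglongrightarrow> z"
proof -
  have "\<exists>\<^sub>F k in sequentially. x k \<in> C"
    using C(2) by simp
  then obtain z where z: "z \<in> C" "seq_cluster_point x z"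
    using frequently_in_compact_imp_cluster_point[OF C(1)] by blast
  obtain d where d: "0 < d" "\<And>w. seq_cluster_point x w \<Longrightarrow> w \<noteq> z \<Longrightarrow> d \<le> dist z w"
    using finite_set_avoid[OF fin, of z] by auto
  have "\<forall>\<^sub>F k in sequentially. dist (x k) z < e" if "0 < e" for e
  proof -
    \<comment> \<open>As \<open>2 * r < d\<close>, the closed shell between radii \<open>r\<close>
      and \<open>2 * r\<close> contains neither \<open>z\<close> nor any other cluster
      point.\<close>
    define r where "r = min e (d / 3)"
    have r: "0 < r" "r \<le> e" "2 * r < d"
      using that d by (auto simp: r_def)
    define A where "A = C \<inter> (cball z (2 * r) - ball z r)"
    have "compact A"
      unfolding A_def using C(1) by (intro compact_Int_closed) (auto simp: closed_Diff)
    moreover have "\<not> seq_cluster_point x w" if "w \<in> A" for w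
      using d(2)[of w] that r by (cases "w = z") (auto simp: A_def)
    ultimately have "\<not> (\<exists>\<^sub>F k in sequentially. x k \<in> A)"
      using frequently_in_compact_imp_cluster_point by blast
    then have "\<forall>\<^sub>F k in sequentially. x k \<notin> A"
      by (simp add: not_frequently)
    moreover have "\<forall>\<^sub>F k in sequentially. dist (x (Suc k)) (x k) < r"
      using steps r(1) by (intro order_tendstoD)
    ultimately have "\<forall>\<^sub>F k in sequentially. x k \<notin> A \<and> dist (x (Suc k)) (x k) < r"
      by eventually_elim simp
    then obtain N where N: "\<And>k. N \<le> k \<Longrightarrow> x k \<notin> A" "\<And>k. N \<le> k \<Longrightarrow> dist (x (Suc k)) (x k) < r"
      by (auto simp: eventually_sequentially)
    have "\<exists>\<^sub>F k in sequentially. x k \<in> ball z r"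
      using z(2) r(1) unfolding seq_cluster_point_def by (meson centre_in_ball open_ball)
    then obtain m where m: "N \<le> m" "x m \<in> ball z r"
      by (auto simp: frequently_sequentially)
    have "x k \<in> ball z r" if "m \<le> k" for k
      using that
    proof (induction k rule: dec_induct)
      case (step k)
      \<comment> \<open>A step shorter than \<open>r\<close> from inside the ball stays within the
        outer radius, so leaving the ball would mean landing in the avoided shell
        \<open>A\<close>.\<close>
      have "dist z (x (Suc k)) \<le> 2 * r"
        using step.IH N(2)[of k] step.hyps m(1) dist_triangle[of z "x (Suc k)" "x k"]
        by (simp add: dist_commute)
      then show ?case
        using N(1)[of "Suc k"] step.hyps m(1) C(2) by (auto simp: A_def)
    qed (use m in simp)
    then show ?thesis
      using r(2) by (auto simp: eventually_sequentially dist_commute intro!: exI[of _ m] less_le_trans[of _ r e])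
  qed
  then show ?thesis
    using z by (auto simp: tendsto_iff)
qed

section \<open>Composite convex minimization\<close>

text \<open>\<open>G\<close> is the real-valued form of the extended function on \<open>C\<close>.
  Its convexity and lower semicontinuity are stated relative to \<open>C\<close>, where the extended
  function is finite; \<open>bounded_below\<close> makes the infimum of the objective a genuine real
  number.\<close>

locale composite_minimization =
  fixes C :: "'a::real_normed_vector set" and f :: "'a \<Rightarrow> real"
    and f' :: "'a \<Rightarrow> ('a \<Rightarrow>\<^sub>L real)" and G :: "'a \<Rightarrow> real"
  assumes nonempty: "C \<noteq> {}" and closed: "closed C" and bounded: "bounded C"
    and f_convex: "convex_on UNIV f"
    and f_deriv: "\<And>y. (f has_derivative blinfun_apply (f' y)) (at y)"
    and G_convex: "convex_on C G"
    and G_lsc: "\<And>y c. y \<in> C \<Longrightarrow> c < G y \<Longrightarrow> \<forall>\<^sub>F w in nhds y. w \<in> C \<longrightarrow> c < G w"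
    and bounded_below: "bdd_below ((\<lambda>y. f y + G y) ` C)"
begin

definition \<phi> :: "'a \<Rightarrow> real" where "\<phi> y = f y + G y"

definition minval :: real where "minval = (INF y\<in>C. \<phi> y)"

lemma convex: "convex C"
  using G_convex by (simp add: convex_on_def)

lemma minval_le: "y \<in> C \<Longrightarrow> minval \<le> \<phi> y"
  unfolding minval_def using bounded_below by (intro cINF_lower) (auto simp: \<phi>_def)

lemma minval_greatest: "(\<And>y. y \<in> C \<Longrightarrow> c \<le> \<phi> y) \<Longrightarrow> c \<le> minval"
  unfolding minval_def using nonempty by (intro cINF_greatest)

lemma tangent: "f y + f' y (w - y) \<le> f w"
  using convex_on_above_tangent[OF f_convex f_deriv] .

lemma \<phi>_convex: "convex_on C \<phi>"
  unfolding \<phi>_def using f_convex G_convex convex by (intro convex_on_add) (auto intro: convex_on_subset)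

lemma convex_sublevel: "convex {y \<in> C. \<phi> y \<le> c}"
proof (rule convexI)
  fix y w and u v :: real
  assume *: "y \<in> {y \<in> C. \<phi> y \<le> c}" "w \<in> {y \<in> C. \<phi> y \<le> c}" "0 \<le> u" "0 \<le> v" "u + v = 1"
  then have "\<phi> (u *\<^sub>R y + v *\<^sub>R w) \<le> u * \<phi> y + v * \<phi> w"
    using \<phi>_convex by (auto simp: convex_on_def)
  also have "\<dots> \<le> c"
    using * by (intro convex_bound_le) auto
  finally show "u *\<^sub>R y + v *\<^sub>R w \<in> {y \<in> C. \<phi> y \<le> c}"
    using * convex by (auto intro: convexD)
qed

text \<open>If the limit \<open>y\<close> had value above \<open>c\<close>, a number
  \<open>b\<close> strictly between \<open>c - f y\<close> and \<open>G y\<close> would give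
  \<open>f > c - b\<close> by continuity and \<open>G > b\<close> by semicontinuity along the tail,
  contradicting membership in the sublevel set.\<close>

lemma closed_sublevel: "closed {y \<in> C. \<phi> y \<le> c}"
  unfolding closed_sequential_limits
proof (intro allI impI, elim conjE)
  fix s y assume s: "\<forall>n. s n \<in> {y \<in> C. \<phi> y \<le> c}" and lim: "s \<longlonglongrightarrow> y"
  have y: "y \<in> C"
    using s lim closed by (auto simp: closed_sequential_limits)
  have "\<phi> y \<le> c"
  proof (rule ccontr)
    assume "\<not> \<phi> y \<le> c"
    then obtain b where b: "c - f y < b" "b < G y"
      using dense[of "c - f y" "G y"] by (auto simp: \<phi>_def)
    have "isCont f y"
      using f_deriv has_derivative_continuous by blast
    then have "(\<lambda>n. f (s n)) \<longlonglongrightarrow> f y"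
      using lim isCont_tendsto_compose by blast
    then have "\<forall>\<^sub>F n in sequentially. c - b < f (s n)"
      using b by (intro order_tendstoD) auto
    moreover have "\<forall>\<^sub>F n in sequentially. s n \<in> C \<longrightarrow> b < G (s n)"
      using G_lsc[OF y b(2)] lim by (rule eventually_compose_filterlim)
    ultimately have "\<forall>\<^sub>F n in sequentially. False"
    proof eventually_elim
      case (elim n)
      then show ?case using s[rule_format, of n] by (simp add: \<phi>_def)
    qed
    then show False
      by simp
  qed
  with y show "y \<in> {y \<in> C. \<phi> y \<le> c}"
    by simp
qed

section \<open>Existence and uniqueness of minimizers\<close>

text \<open>The set \<open>S\<close> is the whole space when a minimizer is sought, and a closed
  half-space in the proof of weak convergence.\<close>

lemma attains_minval_in_closed_convex:
  assumes refl: "reflexive_space TYPE('a)"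
    and S: "closed S" "convex S"
    and approx: "\<And>e. 0 < e \<Longrightarrow> \<exists>y\<in>C \<inter> S. \<phi> y \<le> minval + e"
  shows "\<exists>y\<in>C \<inter> S. \<phi> y = minval"
proof -
  define K where "K n = {y \<in> C. \<phi> y \<le> minval + 1 / real (Suc n)} \<inter> S" for n
  have "(\<Inter>n. K n) \<noteq> {}"
  proof (rule reflexive_decreasing_Inter_nonempty[OF refl])
    show "closed (K n)" "convex (K n)" for n
      unfolding K_def using S closed_sublevel convex_sublevel by (auto intro: closed_Int convex_Int)
    show "K n \<noteq> {}" for n
      using approx[of "1 / real (Suc n)"] by (auto simp: K_def)
    have "1 / real (Suc n) \<le> 1 / real (Suc m)" if "m \<le> n" for m n
      using that by (intro divide_left_mono) auto
    then show "decseq K"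
      unfolding decseq_def K_def by fastforce
    show "bounded (K 0)"
      using bounded by (rule bounded_subset) (auto simp: K_def)
  qed
  then obtain y where y: "\<And>n. y \<in> K n"
    by auto
  have "\<phi> y \<le> minval + e" if "0 < e" for e
  proof -
    obtain n where "1 / real (Suc n) < e"
      using reals_Archimedean[OF \<open>0 < e\<close>] by (auto simp: inverse_eq_divide)
    then show ?thesis
      using y[of n] by (simp add: K_def)
  qed
  then have "\<phi> y \<le> minval"
    by (rule field_le_epsilon)
  then show ?thesis
    using y[of 0] minval_le[of y] by (auto simp: K_def)
qed

lemma approximate_minimizer: "0 < e \<Longrightarrow> \<exists>y\<in>C. \<phi> y \<le> minval + e"
  using minval_greatest[of "minval + e"] by (meson add_le_same_cancel1 linorder_not_le nle_le)

lemma minimizer_exists: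
  assumes "reflexive_space TYPE('a)"
  shows "\<exists>z\<in>C. \<phi> z = minval"
  using attains_minval_in_closed_convex[OF assms, of UNIV] approximate_minimizer by auto

text \<open>The midpoint of two distinct minimizers would have a value below
  \<open>minval\<close>.\<close>

lemma strictly_convex_minimizer_unique:
  assumes "strictly_convex f" and yz: "y \<in> C" "\<phi> y = minval" "z \<in> C" "\<phi> z = minval"
  shows "y = z"
proof (rule ccontr)
  let ?m = "(1/2) *\<^sub>R y + (1 - 1/2) *\<^sub>R z"
  assume "y \<noteq> z"
  then have "f ?m < (1/2) * f y + (1 - 1/2) * f z"
    using assms(1) unfolding strictly_convex_def
    by (metis field_sum_of_halves greaterThanLessThan_iff half_gt_zero_iff less_add_same_cancel1 zero_less_one)
  moreover have "G ?m \<le> (1/2) * G y + (1 - 1/2) * G z"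
    using convex_onD[OF G_convex, of "1/2" y z] yz by simp
  moreover have "minval \<le> \<phi> ?m"
    using yz by (intro minval_le convexD[OF convex]) auto
  ultimately show False
    using yz by (simp add: \<phi>_def)
qed

section \<open>Weak and strong convergence of minimizing sequences\<close>

lemma strictly_convex_minimizing_weakly_converges:
  assumes refl: "reflexive_space TYPE('a)" and strict: "strictly_convex f"
    and x: "\<And>k. x k \<in> C" "(\<lambda>k. \<phi> (x k)) \<longlonglongrightarrow> minval"
    and z: "z \<in> C" "\<phi> z = minval"
  shows "weakly_converges_to x z"
proof -
  have upper: "\<forall>\<^sub>F k in sequentially. l (x k) < c" if "l z < c" for l :: "'a \<Rightarrow>\<^sub>L real" and c
  proof (rule ccontr)
    assume "\<not> (\<forall>\<^sub>F k in sequentially. l (x k) < c)"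
    then have freq: "\<exists>\<^sub>F k in sequentially. c \<le> l (x k)"
      by (simp add: not_eventually not_less)
    \<comment> \<open>Infinitely many visits to the half-space supply points in it with values
      arbitrarily close to \<open>minval\<close>. The resulting minimizer differs from
      \<open>z\<close>, since \<open>l z < c\<close>.\<close>
    have "\<exists>y\<in>C \<inter> {y. c \<le> l y}. \<phi> y = minval"
    proof (rule attains_minval_in_closed_convex[OF refl])
      show "closed {y. c \<le> l y}"
        by (intro closed_Collect_le continuous_intros)
      show "convex {y. c \<le> l y}"
      proof (rule convexI)
        fix y w and u v :: real
        assume *: "y \<in> {y. c \<le> l y}" "w \<in> {y. c \<le> l y}" "0 \<le> u" "0 \<le> v" "u + v = 1"
        have "c = u * c + v * c"
          using * by (metis distrib_right mult_1)
        also have "\<dots> \<le> u * l y + v * l w"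
          using * by (intro add_mono mult_left_mono) auto
        finally show "u *\<^sub>R y + v *\<^sub>R w \<in> {y. c \<le> l y}"
          by (simp add: blinfun.add_right blinfun.scaleR_right)
      qed
      fix e :: real assume "0 < e"
      then have "\<forall>\<^sub>F k in sequentially. \<phi> (x k) < minval + e"
        using x(2) by (intro order_tendstoD) auto
      with freq have "\<exists>\<^sub>F k in sequentially. \<phi> (x k) < minval + e \<and> c \<le> l (x k)"
        by (rule frequently_eventually_conj)
      then show "\<exists>y\<in>C \<inter> {y. c \<le> l y}. \<phi> y \<le> minval + e"
        using x(1) by (force dest: frequently_ex)
    qed
    then show False
      using strictly_convex_minimizer_unique[OF strict _ _ z] that by auto
  qed
  show ?thesis
    unfolding weakly_converges_to_def
  proof (intro allI order_tendstoI)
    fix l :: "'a \<Rightarrow>\<^sub>L real" and c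
    show "\<forall>\<^sub>F k in sequentially. l (x k) < c" if "l z < c"
      using upper that .
    show "\<forall>\<^sub>F k in sequentially. c < l (x k)" if "c < l z"
      \<comment> \<open>The lower estimate is the upper estimate for the opposite
        functional.\<close>
      using upper[of "- l" "- c"] that by (simp add: uminus_blinfun.rep_eq)
  qed
qed

lemma uniformly_convex_minimizing_converges:
  assumes unif: "uniformly_convex f"
    and x: "\<And>k. x k \<in> C" "(\<lambda>k. \<phi> (x k)) \<longlonglongrightarrow> minval"
    and z: "z \<in> C" "\<phi> z = minval"
  shows "x \<longlonglongrightarrow> z"
proof -
  obtain \<delta> where \<delta>: "continuous_on {0..} \<delta>" "\<And>t. 0 < t \<Longrightarrow> 0 < \<delta> t"
    and uc: "\<And>x y c. c \<in> {0<..<1} \<Longrightarrow> f (c *\<^sub>R x + (1 - c) *\<^sub>R y)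
      \<le> c * f x + (1 - c) * f y - c * (1 - c) * \<delta> (norm (x - y))"
    using unif unfolding uniformly_convex_def by metis
  \<comment> \<open>Uniform convexity at the midpoint of \<open>y\<close> and \<open>z\<close> gains
    a quarter of \<open>\<delta>\<close>, while the midpoint value is at least
    \<open>minval\<close>.\<close>
  have gap: "\<delta> (norm (y - z)) \<le> 2 * (\<phi> y - minval)" if y: "y \<in> C" for y
  proof -
    let ?m = "(1/2) *\<^sub>R y + (1 - 1/2) *\<^sub>R z"
    have "f ?m \<le> (1/2) * f y + (1 - 1/2) * f z - 1/2 * (1 - 1/2) * \<delta> (norm (y - z))"
      using uc[of "1/2" y z] by simp
    moreover have "G ?m \<le> (1/2) * G y + (1 - 1/2) * G z"
      using convex_onD[OF G_convex, of "1/2" y z] y z by simp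
    moreover have "minval \<le> \<phi> ?m"
      using y z by (intro minval_le convexD[OF convex]) auto
    ultimately show ?thesis
      using z by (simp add: \<phi>_def)
  qed
  obtain D where D: "\<And>y. y \<in> C \<Longrightarrow> norm (y - z) \<le> D"
    using bounded unfolding bounded_any_center[of C z] by (auto simp: dist_norm norm_minus_commute)
  show ?thesis
    unfolding tendsto_iff
  proof (intro allI impI)
    fix e :: real assume e: "0 < e"
    show "\<forall>\<^sub>F k in sequentially. dist (x k) z < e"
    proof (cases "e \<le> D")
      case False
      then show ?thesis
        using D[OF x(1)] by (intro always_eventually allI) (simp add: dist_norm not_le le_less_trans[where y = D])
    next
      case True
      have "continuous_on {e..D} \<delta>"
        using e by (intro continuous_on_subset[OF \<delta>(1)]) auto
      \<comment> \<open>\<open>\<delta>\<close> is not assumed monotone; its positive lower bound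
        for distances between \<open>e\<close> and \<open>D\<close> comes from its minimum on this
        compact interval.\<close>
      then obtain t where t: "t \<in> {e..D}" "\<And>s. s \<in> {e..D} \<Longrightarrow> \<delta> t \<le> \<delta> s"
        using continuous_attains_inf[of "{e..D}" \<delta>] True by auto
      have "0 < \<delta> t"
        using t(1) e \<delta>(2) by auto
      then have "\<forall>\<^sub>F k in sequentially. \<phi> (x k) < minval + \<delta> t / 2"
        using x(2) by (intro order_tendstoD) auto
      then show ?thesis
      proof eventually_elim
        case (elim k)
        then have "\<delta> (norm (x k - z)) < \<delta> t"
          using gap[OF x(1)[of k]] by simp
        then have "norm (x k - z) \<notin> {e..D}"
          using t(2)[of "norm (x k - z)"] by auto
        then show ?case
          using D[OF x(1)[of k]] by (auto simp: dist_norm)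
      qed
    qed
  qed
qed

text \<open>The objective is only lower semicontinuous on \<open>C\<close>, so the limit is taken
  through the closed sublevel sets slightly above \<open>minval\<close>.\<close>

lemma limit_minimizer:
  assumes x: "\<And>k. x k \<in> C" "(\<lambda>k. \<phi> (x k)) \<longlonglongrightarrow> minval" and z: "x \<longlonglongrightarrow> z"
  shows "z \<in> C \<and> \<phi> z = minval"
proof -
  have "z \<in> {y \<in> C. \<phi> y \<le> minval + e}" if "0 < e" for e
  proof (rule Lim_in_closed_set[OF closed_sublevel _ _ z])
    have "\<forall>\<^sub>F k in sequentially. \<phi> (x k) < minval + e"
      using x(2) that by (intro order_tendstoD) auto
    then show "\<forall>\<^sub>F k in sequentially. x k \<in> {y \<in> C. \<phi> y \<le> minval + e}"
      by eventually_elim (use x(1) in auto)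
  qed simp
  then have "z \<in> C" "\<phi> z \<le> minval"
    using zero_less_one by (blast, auto intro: field_le_epsilon)
  then show ?thesis
    using minval_le[of z] by auto
qed

text \<open>The upper bound on \<open>f\<close> at the new point \<open>u\<close> is the tangent inequality based at \<open>u\<close>;
  uniform continuity replaces \<open>f' u\<close> by \<open>f' y\<close>.\<close>

lemma conditional_gradient_descent:
  assumes unif: "uniformly_continuous_on C f'" and e: "0 < e"
  shows "\<exists>\<eta>>0. \<forall>y\<in>C. \<forall>w\<in>C. \<forall>t\<in>{0..1}. t \<le> \<eta> \<longrightarrow>
    (\<forall>v\<in>C. f' y w + G w \<le> f' y v + G v) \<longrightarrow>
    \<phi> (y + t *\<^sub>R (w - y)) - minval \<le> (1 - t) * (\<phi> y - minval) + t * e"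
proof -
  obtain D where D: "0 < D" "\<And>y w. y \<in> C \<Longrightarrow> w \<in> C \<Longrightarrow> norm (w - y) \<le> D"
  proof -
    obtain B where B: "0 < B" "\<And>y. y \<in> C \<Longrightarrow> norm y \<le> B"
      using bounded by (auto simp: bounded_pos)
    have "norm (w - y) \<le> 2 * B" if "y \<in> C" "w \<in> C" for y w
      using norm_triangle_ineq4[of w y] B(2)[OF that(1)] B(2)[OF that(2)] by simp
    then show ?thesis
      using that[of "2 * B"] B(1) by simp
  qed
  \<comment> \<open>The tolerance \<open>e / D\<close> becomes \<open>e\<close> after multiplication
    by the diameter bound \<open>D\<close>.\<close>
  obtain d where d: "0 < d" "\<And>y u. y \<in> C \<Longrightarrow> u \<in> C \<Longrightarrow> dist u y < d \<Longrightarrow> dist (f' u) (f' y) < e / D"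
    using unif e D(1) unfolding uniformly_continuous_on_def by (metis divide_pos_pos)
  have "\<phi> (y + t *\<^sub>R (w - y)) - minval \<le> (1 - t) * (\<phi> y - minval) + t * e"
    if y: "y \<in> C" and w: "w \<in> C" and t: "0 \<le> t" "t \<le> 1" "t \<le> d / (2 * D)"
      and opt: "\<And>v. v \<in> C \<Longrightarrow> f' y w + G w \<le> f' y v + G v" for y w t
  proof -
    define u where "u = y + t *\<^sub>R (w - y)"
    have u_eq: "u = (1 - t) *\<^sub>R y + t *\<^sub>R w"
      by (simp add: u_def algebra_simps)
    have u: "u \<in> C"
      unfolding u_eq using convex y w t by (intro convexD) auto
    \<comment> \<open>The factor 2 in the step bound gives displacement at most
      \<open>d / 2\<close>, hence strictly less than \<open>d\<close>.\<close>
    have "norm (t *\<^sub>R (w - y)) \<le> (d / (2 * D)) * D"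
      unfolding norm_scaleR using t D(2)[OF y w] D(1) by (intro mult_mono) auto
    also have "\<dots> < d"
      using d(1) D(1) by simp
    finally have close: "dist (f' u) (f' y) < e / D"
      using d(2)[OF y u] by (simp add: u_def dist_norm)
    have "(f' u - f' y) (w - y) \<le> norm (f' u - f' y) * norm (w - y)"
      using norm_blinfun[of "f' u - f' y" "w - y"] by simp
    also have "\<dots> \<le> (e / D) * D"
      using close D(2)[OF y w] e D(1) by (intro mult_mono) (auto simp: dist_norm)
    finally have "f' u (w - y) \<le> f' y (w - y) + e"
      using D(1) by (simp add: minus_blinfun.rep_eq)
    then have "t * f' u (w - y) \<le> t * (f' y (w - y) + e)"
      using t(1) by (rule mult_left_mono)
    moreover have "f u \<le> f y + t * f' u (w - y)"
      using tangent[of u y] by (simp add: u_def blinfun.minus_right blinfun.scaleR_right)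
    ultimately have fu: "f u \<le> f y + t * (f' y w - f' y y) + t * e"
      by (simp add: blinfun.diff_right algebra_simps)
    have Gu: "G u \<le> (1 - t) * G y + t * G w"
      unfolding u_eq using convex_onD[OF G_convex t(1,2) y w] .
    \<comment> \<open>The linearized objective lies below the true one on \<open>C\<close>, and
      \<open>w\<close> minimizes it, so its minimal value is a lower bound for the
      objective.\<close>
    have "f' y w + G w - f' y y + f y \<le> minval"
    proof (rule minval_greatest)
      fix v assume "v \<in> C"
      then show "f' y w + G w - f' y y + f y \<le> \<phi> v"
        using opt[of v] tangent[of y v] by (simp add: \<phi>_def blinfun.diff_right)
    qed
    then have "t * (f' y w + G w - f' y y + f y) \<le> t * minval"
      using t(1) by (rule mult_left_mono)
    with fu Gu show ?thesis
      unfolding u_def[symmetric] by (simp add: \<phi>_def algebra_simps)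
  qed
  then show ?thesis
    using d(1) D(1) by (intro exI[of _ "d / (2 * D)"]) auto
qed

section \<open>Convergence of the objective values\<close>

text \<open>Both stepsize rules lead to the same averaged recursion. An exact line search does at
  least as well as one fixed small step, and open loop steps eventually fall below the threshold of
  the descent estimate while their sum diverges.\<close>

theorem frank_wolfe_values_converge:
  assumes unif: "uniformly_continuous_on C f'"
    and x: "\<And>k. x k \<in> C" and xbar: "\<And>k. xbar k \<in> C"
    and opt: "\<And>k v. v \<in> C \<Longrightarrow> f' (x k) (xbar k) + G (xbar k) \<le> f' (x k) v + G v"
    and step: "\<And>k. x (Suc k) = x k + \<gamma> k *\<^sub>R (xbar k - x k)"
    and rule: "(\<forall>k. \<forall>t\<in>{0..1}. \<phi> (x (Suc k)) \<le> \<phi> (x k + t *\<^sub>R (xbar k - x k))) \<or> open_loop \<gamma>"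
  shows "(\<lambda>k. \<phi> (x k)) \<longlonglongrightarrow> minval"
proof (rule order_tendstoI)
  fix c assume "c < minval"
  then show "\<forall>\<^sub>F k in sequentially. c < \<phi> (x k)"
    using minval_le[OF x] by (intro always_eventually allI) (rule less_le_trans)
next
  fix c assume c: "minval < c"
  \<comment> \<open>Half the gap leaves the strict room between the error level and the target that
    the recursion lemma requires.\<close>
  define e where "e = (c - minval) / 2"
  have e: "0 < e" "e < c - minval"
    using c by (auto simp: e_def)
  obtain \<eta> where \<eta>: "0 < \<eta>" and descent: "\<And>k t. 0 \<le> t \<Longrightarrow> t \<le> 1 \<Longrightarrow> t \<le> \<eta> \<Longrightarrow>
      \<phi> (x k + t *\<^sub>R (xbar k - x k)) - minval \<le> (1 - t) * (\<phi> (x k) - minval) + t * e"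
    using conditional_gradient_descent[OF unif e(1)] x xbar opt by (metis atLeastAtMost_iff)
  have "\<exists>\<sigma>. (\<forall>\<^sub>F k in sequentially. \<sigma> k \<le> 1 \<and>
        \<phi> (x (Suc k)) - minval \<le> (1 - \<sigma> k) * (\<phi> (x k) - minval) + \<sigma> k * e) \<and>
      filterlim (\<lambda>n. \<Sum>k<n. \<sigma> k) at_top sequentially"
    using rule
  proof
    assume line: "\<forall>k. \<forall>t\<in>{0..1}. \<phi> (x (Suc k)) \<le> \<phi> (x k + t *\<^sub>R (xbar k - x k))"
    define s where "s = min 1 \<eta>"
    have s: "0 < s" "s \<le> 1" "s \<le> \<eta>"
      using \<eta> by (auto simp: s_def)
    have "\<phi> (x (Suc k)) - minval \<le> (1 - s) * (\<phi> (x k) - minval) + s * e" for k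
    proof -
      have "\<phi> (x (Suc k)) \<le> \<phi> (x k + s *\<^sub>R (xbar k - x k))"
        using line s by auto
      then show ?thesis
        using descent[of s k] s by simp
    qed
    moreover have "filterlim (\<lambda>n. real n * s) at_top sequentially"
      using s(1) by (intro filterlim_at_top_mult_tendsto_pos[OF tendsto_const] filterlim_real_sequentially)
    ultimately show ?thesis
      using s(2) by (intro exI[of _ "\<lambda>_. s"]) simp
  next
    assume ol: "open_loop \<gamma>"
    then have \<gamma>: "\<And>k. 0 < \<gamma> k \<and> \<gamma> k \<le> 1" and lim: "\<gamma> \<longlonglongrightarrow> 0"
      and div: "filterlim (\<lambda>n. \<Sum>k<n. \<gamma> k) at_top sequentially"
      by (auto simp: open_loop_def image_subset_iff)
    have "\<forall>\<^sub>F k in sequentially. \<gamma> k < \<eta>"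
      using lim \<eta> by (rule order_tendstoD)
    then have "\<forall>\<^sub>F k in sequentially. \<gamma> k \<le> 1 \<and>
        \<phi> (x (Suc k)) - minval \<le> (1 - \<gamma> k) * (\<phi> (x k) - minval) + \<gamma> k * e"
    proof eventually_elim
      case (elim k)
      then show ?case
        using \<gamma>[of k] descent[of "\<gamma> k" k] by (simp add: step)
    qed
    with div show ?thesis
      by blast
  qed
  then have "\<forall>\<^sub>F k in sequentially. \<phi> (x k) - minval < c - minval"
    using averaged_recursion_eventually_less[where h = "\<lambda>k. \<phi> (x k) - minval", OF _ _ e(2)] by blast
  then show "\<forall>\<^sub>F k in sequentially. \<phi> (x k) < c"
    by simp
qed

end

section \<open>Convergence of the generalized Frank-Wolfe algorithm\<close>

theorem theorem5p3:
  fixes C :: "'a::banach set"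
    and f :: "'a \<Rightarrow> real"
    and f' :: "'a \<Rightarrow> ('a \<Rightarrow>\<^sub>L real)"
    and g :: "'a \<Rightarrow> ereal"
    and \<gamma> :: "nat \<Rightarrow> real"
    and xbar x :: "nat \<Rightarrow> 'a"
  assumes "reflexive_space TYPE('a)"
    and "C \<noteq> {}" and "closed C" and "bounded C" and "convex C"
    and "convex_on UNIV f"
    and "\<And>y. (f has_derivative blinfun_apply (f' y)) (at y)"
    and "continuous_on UNIV f'"
    and "uniformly_continuous_on C f'"
    and "proper_fun g" and "lower_semicontinuous g" and "ereal_convex g"
    and "C \<subseteq> {y. g y < \<infinity>}"
    and "frank_wolfe C f' g \<gamma> xbar x"
    and "line_minimization (objective f g) \<gamma> xbar x \<or> open_loop \<gamma>"
  shows "(strictly_convex f \<longrightarrow>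
            (\<exists>z. {w. minimizer_on C (objective f g) w} = {z} \<and> weakly_converges_to x z))
       \<and> (uniformly_convex f \<longrightarrow>
            (\<exists>z. {w. minimizer_on C (objective f g) w} = {z} \<and> x \<longlonglongrightarrow> z))
       \<and> (compact C \<and> open_loop \<gamma> \<and> finite {z. seq_cluster_point x z} \<longrightarrow>
            (\<exists>z. minimizer_on C (objective f g) z \<and> x \<longlonglongrightarrow> z))"
proof -
  note refl = assms(1) and C = assms(2-5) and f = assms(6,7) and unif = assms(9) and g = assms(10-13)
    and fw = assms(14) and rule = assms(15)
  \<comment> \<open>The conversion returns 0 at infinite values; on \<open>C\<close> the function
    \<open>g\<close> is finite, so there \<open>G\<close> represents it faithfully.\<close>
  define G where "G y = real_of_ereal (g y)" for y
  have gG: "g y = ereal (G y)" if "y \<in> C" for y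
    using g(1,4) that by (auto simp: G_def proper_fun_def ereal_real subset_iff)
  have G_convex: "convex_on C G"
  proof (rule convex_onI)
    fix t y w assume t: "0 < t" "t < (1::real)" and yw: "y \<in> C" "w \<in> C"
    have "(1 - t) *\<^sub>R y + t *\<^sub>R w \<in> C"
      using C(4) yw t by (intro convexD) auto
    moreover have "1 - t \<in> {0<..<1}"
      using t by auto
    then have "g ((1 - t) *\<^sub>R y + (1 - (1 - t)) *\<^sub>R w) \<le> ereal (1 - t) * g y + ereal (1 - (1 - t)) * g w"
      using g(3) unfolding ereal_convex_def by blast
    ultimately show "G ((1 - t) *\<^sub>R y + t *\<^sub>R w) \<le> (1 - t) * G y + t * G w"
      by (simp add: gG yw)
  qed (rule C(4))
  have G_lsc: "\<forall>\<^sub>F w in nhds y. w \<in> C \<longrightarrow> c < G w" if "y \<in> C" "c < G y" for y c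
  proof -
    have "ereal c < Liminf (nhds y) g"
      using that g(2) gG[of y] unfolding lower_semicontinuous_def
      by (metis ereal_less_eq(3) not_le order_trans)
    then have "\<forall>\<^sub>F w in nhds y. ereal c < g w"
      by (rule less_LiminfD)
    then show ?thesis
      by eventually_elim (auto simp: gG)
  qed
  have xbar: "xbar k \<in> C" for k
    using fw by (auto simp: frank_wolfe_def is_arg_min_def)
  have opt: "f' (x k) (xbar k) + G (xbar k) \<le> f' (x k) v + G v" if "v \<in> C" for k v
  proof -
    have "ereal (f' (x k) (xbar k)) + g (xbar k) \<le> ereal (f' (x k) v) + g v"
      using fw that by (auto simp: frank_wolfe_def is_arg_min_linorder)
    then show ?thesis
      by (simp add: gG that xbar)
  qed
  have step: "x (Suc k) = x k + \<gamma> k *\<^sub>R (xbar k - x k)" for k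
    using fw by (simp add: frank_wolfe_def)
  have \<gamma>: "0 \<le> \<gamma> k \<and> \<gamma> k \<le> 1" for k
    using rule
    by (auto simp: line_minimization_def is_arg_min_def open_loop_def image_subset_iff less_imp_le)
  have segment: "x k + t *\<^sub>R (xbar k - x k) \<in> C" if "x k \<in> C" "0 \<le> t" "t \<le> 1" for k t
  proof -
    have "(1 - t) *\<^sub>R x k + t *\<^sub>R xbar k \<in> C"
      using C(4) that xbar by (intro convexD) auto
    then show ?thesis
      by (simp add: algebra_simps)
  qed
  have x: "x k \<in> C" for k
  proof (induction k)
    case 0
    then show ?case using fw by (simp add: frank_wolfe_def)
  next
    case (Suc k)
    then show ?case using segment[of k "\<gamma> k"] \<gamma>[of k] by (simp add: step)
  qed
  \<comment> \<open>The first subproblem already certifies boundedness: the tangent inequality at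
    \<open>x 0\<close> and optimality of \<open>xbar 0\<close> give an explicit lower bound on
    \<open>C\<close>.\<close>
  have bdd: "bdd_below ((\<lambda>y. f y + G y) ` C)"
  proof (rule bdd_belowI2)
    fix y assume "y \<in> C"
    then show "f (x 0) - f' (x 0) (x 0) + f' (x 0) (xbar 0) + G (xbar 0) \<le> f y + G y"
      using opt[of y 0] convex_on_above_tangent[OF f, of "x 0" y] by (simp add: blinfun.diff_right)
  qed
  interpret composite_minimization C f f' G
    using C f G_convex G_lsc bdd by unfold_locales auto
  have objective: "objective f g y = ereal (\<phi> y)" if "y \<in> C" for y
    using that by (simp add: objective_def \<phi>_def gG)
  have minimizer_iff: "minimizer_on C (objective f g) z \<longleftrightarrow> z \<in> C \<and> \<phi> z = minval" for z
  proof
    assume "minimizer_on C (objective f g) z"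
    then have "z \<in> C" "\<And>y. y \<in> C \<Longrightarrow> \<phi> z \<le> \<phi> y"
      by (auto simp: is_arg_min_linorder objective)
    then show "z \<in> C \<and> \<phi> z = minval"
      using minval_le minval_greatest by (auto intro: antisym)
  next
    assume "z \<in> C \<and> \<phi> z = minval"
    then show "minimizer_on C (objective f g) z"
      using minval_le by (auto simp: is_arg_min_linorder objective)
  qed
  have "(\<forall>k. \<forall>t\<in>{0..1}. \<phi> (x (Suc k)) \<le> \<phi> (x k + t *\<^sub>R (xbar k - x k)))"
    if line: "line_minimization (objective f g) \<gamma> xbar x"
  proof (intro allI ballI)
    fix k and t :: real assume t: "t \<in> {0..1}"
    then have "objective f g (x (Suc k)) \<le> objective f g (x k + t *\<^sub>R (xbar k - x k))"
      using line by (auto simp: line_minimization_def is_arg_min_linorder step)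
    then show "\<phi> (x (Suc k)) \<le> \<phi> (x k + t *\<^sub>R (xbar k - x k))"
      using t by (simp add: objective x segment)
  qed
  then have vals_lim: "(\<lambda>k. \<phi> (x k)) \<longlonglongrightarrow> minval"
    using rule by (intro frank_wolfe_values_converge[where x = x and xbar = xbar and \<gamma> = \<gamma>,
          OF unif x xbar opt step]) auto
  obtain z where z: "z \<in> C" "\<phi> z = minval"
    using minimizer_exists[OF refl] by blast
  have unique: "{w. minimizer_on C (objective f g) w} = {z}" if "strictly_convex f"
    unfolding minimizer_iff using strictly_convex_minimizer_unique[OF that _ _ z] z by blast
  show ?thesis
  proof (intro conjI impI; (elim conjE)?)
    assume "strictly_convex f"
    then show "\<exists>z. {w. minimizer_on C (objective f g) w} = {z} \<and> weakly_converges_to x z"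
      using unique strictly_convex_minimizing_weakly_converges[where x = x, OF refl _ x vals_lim z] by blast
  next
    assume unif_convex: "uniformly_convex f"
    then show "\<exists>z. {w. minimizer_on C (objective f g) w} = {z} \<and> x \<longlonglongrightarrow> z"
      using unique[OF uniformly_convex_imp_strictly_convex]
        uniformly_convex_minimizing_converges[where x = x, OF _ x vals_lim z] by blast
  next
    assume compact: "compact C" and ol: "open_loop \<gamma>" and fin: "finite {z. seq_cluster_point x z}"
    obtain B where B: "\<And>y. y \<in> C \<Longrightarrow> norm y \<le> B"
      using C(3) by (auto simp: bounded_iff)
    \<comment> \<open>Each step has length at most \<open>\<gamma> k\<close> times the diameter
      bound \<open>2 * B\<close>, and the open loop rule sends \<open>\<gamma> k\<close> to
      0.\<close>
    have "(\<lambda>k. dist (x (Suc k)) (x k)) \<longlonglongrightarrow> 0"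
    proof (rule Lim_null_comparison)
      have "norm (dist (x (Suc k)) (x k)) \<le> \<gamma> k * (2 * B)" for k
        using \<gamma>[of k] norm_triangle_ineq4[of "xbar k" "x k"] B[OF x, of k] B[OF xbar, of k]
        by (auto simp: step dist_norm intro!: mult_left_mono)
      then show "\<forall>\<^sub>F k in sequentially. norm (dist (x (Suc k)) (x k)) \<le> \<gamma> k * (2 * B)"
        by simp
      show "(\<lambda>k. \<gamma> k * (2 * B)) \<longlonglongrightarrow> 0"
        using ol by (intro tendsto_mult_left_zero) (simp add: open_loop_def)
    qed
    then obtain w where "x \<longlonglongrightarrow> w"
      using finitely_many_cluster_points_imp_convergent[where x = x, OF compact x _ fin] by blast
    then show "\<exists>z. minimizer_on C (objective f g) z \<and> x \<longlonglongrightarrow> z"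
      using limit_minimizer[where x = x, OF x vals_lim] minimizer_iff by blast
  qed
qed

end
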